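(* Consider the model with government spending and the truncated Markov chain described in the context, with terminal (absorbing-state) steady state inflation $\pi^{ss}$. Assume that $$\psi>m_{x\pi}+\frac{(1-m_{xx})(\beta m_{\pi\pi}-1)}{\kappa(1+\eta\bar c)\sigma},$$ that $d>\bar d(0,\pi^{ss})$, and that $p\in(0,1]$. Then, regardless of $p$, the impact consumption multiplier $m^{c,L}_g(\ell)$ is positive and strictly increasing in $\ell$. In addition, for given initial conditions $m^{c,L}_g(1),m^{c,L}_g(2)$, the impact consumption multiplier can be written as the following AR(2) process: $$m^{c,L}_g(\ell+2)=\tau_p^*\,m^{c,L}_g(\ell+1)-\delta_p^*\,m^{c,L}_g(\ell)+c_m^*\qquad\text{for }\ell\geq1,$$ where $\tau_p^*=\operatorname{tr}(p\mathbf{A}^* )$, $\delta_p^*=\det(p\mathbf{A}^* )$ and $c_m^*:=(1-\tau_p^*+\delta_p^* )\,m^{c,L}_g(\infty)$. Further, there exists a threshold $\bar p$ such that: - $\lim_{\ell\to\infty}m^{c,L}_g(\ell)=m^{c,L}_g(\infty)>0$ if $p<\bar p$; - $\lim_{\ell\to\infty}m^{c,L}_g(\ell)=+\infty$ if $p\geq\bar p$.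
   Context: Parameters: $\sigma,\kappa,\eta,\psi,\mu>0$, $\beta\in(0,1)$, $\bar c\in(0,1)$, $m_{xx},m_{x\pi},m_{\pi\pi}\in(0,1]$. Write $K:=\kappa(1+\eta\bar c)$ and $\bar\pi:=-\mu/\psi$. Model: for each date $t$, $$c_t=m_{xx}\mathbb{E}_tc_{t+1}-\sigma(i_t-m_{x\pi}\mathbb{E}_t\pi_{t+1}+d_t),\quad \pi_t=m_{\pi\pi}\beta\,\mathbb{E}_t\pi_{t+1}+Kc_t+\kappa\eta(1-\bar c)g_t,\quad i_t=\max\{\psi\pi_t,-\mu\},$$ where $c_t$ is private consumption, $\pi_t$ inflation, $i_t$ the nominal interest rate, $d_t$ a demand shock and $g_t$ government spending. The effective lower bound (ELB) binds when $\pi_t\leq\bar\pi$. Truncated Markov chain with maximum duration $\ell$: $d_t$ and $g_t$ are perfectly correlated. At date $t$ the chain starts in the low state, with $(d_t,g_t)=(d,g)$. In periods $t,\dots,t+\ell-1$, from the low state it stays there with probability $p$ and moves to the absorbing state, where $(d_t,g_t)=(0,0)$, with probability $1-p$; the absorbing state is never left. If it is not back in the absorbing state after these $\ell$ periods, it jumps there deterministically. In the absorbing state the economy is in a steady state with inflation $\pi^{ss}$, which may be either the intended steady state ($c=\pi=0$) or the unintended one (the steady state $(c^u,\pi^u)$ with $d=g=0$ and binding ELB, where $\pi^u<\bar\pi<0$). $\tilde c_{t+n}(\ell),\tilde\pi_{t+n}(\ell)$, $n=0,\dots,\ell-1$, denote the equilibrium allocation at $t+n$ conditional on the low state. Threshold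 $\bar d(0,\pi^{ss})$: the value such that a demand shock $d\geq\bar d(0,\pi^{ss})$ is large enough for the economy to be in the ELB regime, i.e. for the ELB to bind in all low-state periods, given that the economy returns to the steady state with inflation $\pi^{ss}$ after the shock. For $\pi^{ss}=0$ it equals $\mu(1+\sigma\psi K)/(\sigma\psi K)$. Matrix: $\mathbf{A}^*$ multiplies expected next-period $[c\ \pi]^\top$ when the first two model equations are solved for $[c_t\ \pi_t]^\top$ with binding ELB ($i_t=-\mu$), i.e. $$\mathbf{A}^*=\begin{bmatrix}m_{xx}&\sigma m_{x\pi}\\ Km_{xx}&\beta m_{\pi\pi}+\sigma Km_{x\pi}\end{bmatrix}.$$ Multiplier: $m^{c,L}_g(\ell)$ is the impact multiplier of government spending on consumption in the ELB regime, i.e. the derivative of $\tilde c_t(\ell)$ with respect to $g$ when the ELB binds in every low-state period; the increase in government spending is assumed not big enough to take the economy out of the ELB. $m^{c,L}_g(\infty)$ is the time-invariant ELB multiplier, i.e. the derivative with respect to $g$ of consumption in the constant low-state allocation with binding ELB under the untruncated ($\ell=\infty$) two-state absorbing Markov chain; it is the fixed point of the recursion, and coincides with the limit of $m^{c,L}_g(\ell)$ when $p<\bar p$.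
   Formalization: If the low state lasts at most dates t,…,t+ℓ−1, the multiplier at ℓ=1 is 0, so positivity is claimed from ℓ=2; where 1−τ+δ=0 (p equal to the threshold) the multiplier at ℓ=∞ does not exist, and the AR(2) is claimed with some constant. *)

theory Defs
  imports "HOL-Probability.Probability" "HOL-Library.Extended_Nat"
begin

record nk_params =
  sig :: real
  kappa :: real
  eta :: real
  psi :: real
  mu :: real
  beta :: real
  cbar :: real
  mxx :: real
  mxpi :: real
  mpipi :: real

definition admissible :: "nk_params \<Rightarrow> bool" where
  "admissible P \<longleftrightarrow>
     0 < sig P \<and> 0 < kappa P \<and> 0 < eta P \<and> 0 < psi P \<and> 0 < mu P \<and>
     beta P \<in> {0<..<1} \<and> cbar P \<in> {0<..<1} \<and>
     mxx P \<in> {0<..1} \<and> mxpi P \<in> {0<..1} \<and> mpipi P \<in> {0<..1}"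

definition slopeK :: "nk_params \<Rightarrow> real" where
  "slopeK P = kappa P * (1 + eta P * cbar P)"

definition pibar :: "nk_params \<Rightarrow> real" where
  "pibar P = - mu P / psi P"

definition policy_rate :: "nk_params \<Rightarrow> real \<Rightarrow> real" where
  "policy_rate P x = max (psi P * x) (- mu P)"

datatype state = Low | Absorbing

text \<open>
  Dates are counted from the start of the low state, so \<open>n\<close> stands for date \<open>t + n\<close>.
  The parameter \<open>l\<close> is the maximum duration, and \<open>l = \<infinity>\<close> gives the untruncated chain.
  The type \<open>expiry\<close> records how the forced exit ``after these \<open>l\<close> periods'' is timed.  With
  \<open>Exit_At_Expiry\<close> the chain is already absorbed at date \<open>l\<close>, so the low dates are
  \<open>0, ..., l - 1\<close>.  With \<open>Exit_After_Expiry\<close> each of the periods \<open>0, ..., l - 1\<close> ends with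
  the random transition, and a chain that is still low at date \<open>l\<close> is absorbed at \<open>l + 1\<close>.
\<close>

datatype expiry = Exit_At_Expiry | Exit_After_Expiry

definition low_date :: "expiry \<Rightarrow> enat \<Rightarrow> nat \<Rightarrow> bool" where
  "low_date e l n \<longleftrightarrow> (case e of Exit_At_Expiry \<Rightarrow> enat n < l | Exit_After_Expiry \<Rightarrow> enat n \<le> l)"

definition transition :: "expiry \<Rightarrow> real \<Rightarrow> enat \<Rightarrow> nat \<Rightarrow> state \<Rightarrow> state pmf" where
  "transition e p l n s =
     (if s = Low \<and> low_date e l (Suc n)
      then map_pmf (\<lambda>stay. if stay then Low else Absorbing) (bernoulli_pmf p)
      else return_pmf Absorbing)"

definition expect_next ::
  "expiry \<Rightarrow> real \<Rightarrow> enat \<Rightarrow> (nat \<Rightarrow> state \<Rightarrow> real) \<Rightarrow> nat \<Rightarrow> state \<Rightarrow> real" where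
  "expect_next e p l x n s = measure_pmf.expectation (transition e p l n s) (x (Suc n))"

definition shock :: "real \<Rightarrow> state \<Rightarrow> real" where
  "shock z s = (if s = Low then z else 0)"

text \<open>The Euler equation and the Phillips curve at date \<open>n\<close> in state \<open>s\<close>, for an arbitrary
  nominal rate \<open>i\<close>.\<close>

definition private_sector ::
  "nk_params \<Rightarrow> expiry \<Rightarrow> real \<Rightarrow> enat \<Rightarrow> real \<Rightarrow> real \<Rightarrow> real \<Rightarrow>
   (nat \<Rightarrow> state \<Rightarrow> real) \<Rightarrow> (nat \<Rightarrow> state \<Rightarrow> real) \<Rightarrow> nat \<Rightarrow> state \<Rightarrow> bool" where
  "private_sector P e p l d g i c \<pi> n s \<longleftrightarrow>
     c n s = mxx P * expect_next e p l c n s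
             - sig P * (i - mxpi P * expect_next e p l \<pi> n s + shock d s) \<and>
     \<pi> n s = mpipi P * beta P * expect_next e p l \<pi> n s + slopeK P * c n s
             + kappa P * eta P * (1 - cbar P) * shock g s"

text \<open>Steady states are pairs of consumption and inflation.\<close>

definition steady_state :: "nk_params \<Rightarrow> real \<times> real \<Rightarrow> bool" where
  "steady_state P ss \<longleftrightarrow> (case ss of (c, \<pi>) \<Rightarrow>
     c = mxx P * c - sig P * (policy_rate P \<pi> - mxpi P * \<pi>) \<and>
     \<pi> = mpipi P * beta P * \<pi> + slopeK P * c)"

definition intended :: "real \<times> real \<Rightarrow> bool" where
  "intended ss \<longleftrightarrow> ss = (0, 0)"

definition unintended :: "nk_params \<Rightarrow> real \<times> real \<Rightarrow> bool" where
  "unintended P ss \<longleftrightarrow> steady_state P ss \<and> snd ss < pibar P"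

text \<open>Allocations are unconstrained at (date, state) pairs that the chain cannot reach.\<close>

definition equilibrium ::
  "nk_params \<Rightarrow> expiry \<Rightarrow> real \<times> real \<Rightarrow> real \<Rightarrow> enat \<Rightarrow> real \<Rightarrow> real \<Rightarrow>
   (nat \<Rightarrow> state \<Rightarrow> real) \<Rightarrow> (nat \<Rightarrow> state \<Rightarrow> real) \<Rightarrow> bool" where
  "equilibrium P e ss p l d g c \<pi> \<longleftrightarrow>
     (\<forall>n s. (s = Low \<longrightarrow> low_date e l n) \<longrightarrow>
        private_sector P e p l d g (policy_rate P (\<pi> n s)) c \<pi> n s) \<and>
     (\<forall>n. (c n Absorbing, \<pi> n Absorbing) = ss)"

definition elb_binds :: "nk_params \<Rightarrow> expiry \<Rightarrow> enat \<Rightarrow> (nat \<Rightarrow> state \<Rightarrow> real) \<Rightarrow> bool" where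
  "elb_binds P e l \<pi> \<longleftrightarrow> (\<forall>n. low_date e l n \<longrightarrow> \<pi> n Low \<le> pibar P)"

text \<open>The least shock from which on the lower bound binds in every low period without
  government spending, whatever the persistence and the maximum duration of the low state.\<close>

definition dbar :: "nk_params \<Rightarrow> expiry \<Rightarrow> real \<times> real \<Rightarrow> real" where
  "dbar P e ss = Inf {D. \<forall>d\<ge>D. \<forall>p\<in>{0<..1}. \<forall>l\<ge>1.
     \<exists>c \<pi>. equilibrium P e ss p (enat l) d 0 c \<pi> \<and> elb_binds P e (enat l) \<pi>}"

lemma expect_next_low:
  assumes "p \<in> {0..1}"
  shows "expect_next e p l x n Low =
    (if low_date e l (Suc n) then p * x (Suc n) Low + (1 - p) * x (Suc n) Absorbing
     else x (Suc n) Absorbing)"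
  using assms by (simp add: expect_next_def transition_def)

lemma expect_next_absorbing: "expect_next e p l x n Absorbing = x (Suc n) Absorbing"
  by (simp add: expect_next_def transition_def)

lemma dbar_intended:
  assumes P: "admissible P"
  shows "dbar P e (0, 0) =
    mu P * (1 + sig P * psi P * slopeK P) / (sig P * psi P * slopeK P)"
proof -
  define K s ps m D0 where "K = slopeK P" and "s = sig P" and "ps = psi P" and "m = mu P"
    and "D0 = m * (1 + s * ps * K) / (s * ps * K)"
  have pos: "K > 0" "s > 0" "ps > 0" "m > 0"
    using P by (auto simp: admissible_def slopeK_def K_def s_def ps_def m_def
        intro!: mult_pos_pos add_pos_pos)
  have D0: "D0 \<le> d \<longleftrightarrow> K * (s * (m - d)) \<le> pibar P" for d
    using pos by (simp add: D0_def pibar_def field_simps flip: m_def ps_def)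
  have "{D. \<forall>d\<ge>D. \<forall>p\<in>{0<..1}. \<forall>l\<ge>1.
     \<exists>c \<pi>. equilibrium P e (0, 0) p (enat l) d 0 c \<pi> \<and> elb_binds P e (enat l) \<pi>} = {D0..}"
    (is "?S = _")
  proof (intro equalityI subsetI)
    fix D assume "D \<in> ?S"
    then have "\<exists>c \<pi>. equilibrium P e (0, 0) 1 (enat 1) D 0 c \<pi> \<and> elb_binds P e (enat 1) \<pi>"
      by simp
    then obtain c \<pi> where eq: "equilibrium P e (0, 0) 1 (enat 1) D 0 c \<pi>"
      and b: "elb_binds P e (enat 1) \<pi>" by blast
    define n :: nat where "n = (case e of Exit_At_Expiry \<Rightarrow> 0 | Exit_After_Expiry \<Rightarrow> 1)"
    have n: "low_date e (enat 1) n" "\<not> low_date e (enat 1) (Suc n)"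
      by (cases e; simp add: low_date_def n_def)+
    have pin: "\<pi> n Low \<le> pibar P" using b n(1) by (auto simp: elb_binds_def)
    then have "psi P * \<pi> n Low \<le> - mu P"
      using pos by (simp add: pibar_def ps_def field_simps)
    then have rate: "policy_rate P (\<pi> n Low) = - mu P" by (simp add: policy_rate_def)
    have ab: "c (Suc n) Absorbing = 0" "\<pi> (Suc n) Absorbing = 0"
      using eq by (auto simp: equilibrium_def)
    have "private_sector P e 1 (enat 1) D 0 (- mu P) c \<pi> n Low"
      using eq n(1) unfolding equilibrium_def rate[symmetric] by blast
    then have "c n Low = s * (m - D)" "\<pi> n Low = K * c n Low"
      using n(2) ab
      by (simp_all add: private_sector_def expect_next_low shock_def K_def s_def m_def algebra_simps)
    then have "\<pi> n Low = K * (s * (m - D))" by simp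
    then show "D \<in> {D0..}" using pin D0 by simp
  next
    fix D assume "D \<in> {D0..}"
    show "D \<in> ?S"
    proof (intro CollectI allI ballI impI)
      fix d p :: real and l :: nat
      assume "D \<le> d" and p: "p \<in> {0<..1}" and "1 \<le> l"
      have "D0 \<le> d" using \<open>D \<in> {D0..}\<close> \<open>D \<le> d\<close> by simp
      then have d: "K * (s * (m - d)) \<le> pibar P" using D0 by blast
      have "pibar P < 0" using pos by (simp add: pibar_def ps_def m_def)
      then have "K * (s * (m - d)) < 0" using d by simp
      then have neg: "s * (m - d) < 0" using pos by (simp add: mult_less_0_iff)
      define N where "N = (case e of Exit_At_Expiry \<Rightarrow> l | Exit_After_Expiry \<Rightarrow> Suc l)"
      have low: "low_date e (enat l) n \<longleftrightarrow> n < N" for n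
        by (cases e) (auto simp: low_date_def N_def)
      define f where "f = (\<lambda>x :: real \<times> real.
        let c = mxx P * (p * fst x) - s * (- m - mxpi P * (p * snd x) + d)
        in (c, mpipi P * beta P * (p * snd x) + K * c))"
      define y where "y k = (f ^^ k) (0, 0)" for k
      have y0: "y 0 = (0, 0)" by (simp add: y_def)
      have yS: "y (Suc k) = f (y k)" for k by (simp add: y_def)
      have step: "fst (f x) \<le> s * (m - d) \<and> snd (f x) \<le> K * (s * (m - d))"
        if x: "fst x \<le> 0" "snd x \<le> 0" for x
      proof -
        have "mxx P * (p * fst x) \<le> 0" "s * (mxpi P * (p * snd x)) \<le> 0"
          "mpipi P * beta P * (p * snd x) \<le> 0"
          using x p P pos(2)
          by (auto simp: admissible_def mult_nonneg_nonpos intro!: mult_nonneg_nonpos)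
        moreover from this have c: "fst (f x) \<le> s * (m - d)"
          by (simp add: f_def Let_def algebra_simps)
        moreover have "snd (f x) = mpipi P * beta P * (p * snd x) + K * fst (f x)"
          by (simp add: f_def Let_def)
        moreover have "K * fst (f x) \<le> K * (s * (m - d))" using c pos by simp
        ultimately show ?thesis by linarith
      qed
      have y_neg: "fst (y k) \<le> 0 \<and> snd (y k) \<le> 0" for k
      proof (induction k)
        case (Suc k)
        then show ?case using step[of "y k"] neg \<open>K * (s * (m - d)) < 0\<close> yS by force
      qed (simp add: y0)
      have y_binds: "snd (y (Suc k)) \<le> pibar P" for k
        using step[of "y k"] y_neg[of k] yS[of k] d by simp
      define c where "c n st = (case st of Low \<Rightarrow> fst (y (N - n)) | Absorbing \<Rightarrow> 0)" for n st
      define \<pi> where "\<pi> n st = (case st of Low \<Rightarrow> snd (y (N - n)) | Absorbing \<Rightarrow> 0)" for n st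
      have binds: "elb_binds P e (enat l) \<pi>"
        unfolding elb_binds_def low
      proof (intro allI impI)
        fix n assume "n < N"
        then have "N - n = Suc (N - Suc n)" by simp
        then show "\<pi> n Low \<le> pibar P" using y_binds by (simp add: \<pi>_def)
      qed
      have "private_sector P e p (enat l) d 0 (policy_rate P (\<pi> n st)) c \<pi> n st"
        if "st = Low \<longrightarrow> low_date e (enat l) n" for n st
      proof (cases st)
        case Low
        with that have n: "n < N" by (simp add: low)
        then have "\<pi> n Low \<le> pibar P" using binds by (simp add: elb_binds_def low)
        then have "psi P * \<pi> n Low \<le> - mu P"
          using pos by (simp add: pibar_def ps_def field_simps)
        then have rate: "policy_rate P (\<pi> n Low) = - m" by (simp add: policy_rate_def m_def)
        have E: "expect_next e p (enat l) c n Low = p * fst (y (N - Suc n))"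
          "expect_next e p (enat l) \<pi> n Low = p * snd (y (N - Suc n))"
          using p by (auto simp: expect_next_low low c_def \<pi>_def y0 not_less)
        have "N - n = Suc (N - Suc n)" using n by simp
        then have "c n Low = fst (f (y (N - Suc n)))" "\<pi> n Low = snd (f (y (N - Suc n)))"
          by (simp_all add: c_def \<pi>_def yS)
        then show ?thesis using Low rate
          by (simp add: private_sector_def E shock_def f_def Let_def K_def s_def)
      next
        case Absorbing
        then show ?thesis using P
          by (simp add: private_sector_def expect_next_absorbing shock_def c_def \<pi>_def
              policy_rate_def admissible_def)
      qed
      then have "equilibrium P e (0, 0) p (enat l) d 0 c \<pi>"
        by (simp add: equilibrium_def c_def \<pi>_def)
      with binds show "\<exists>c \<pi>. equilibrium P e (0, 0) p (enat l) d 0 c \<pi>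
          \<and> elb_binds P e (enat l) \<pi>" by blast
    qed
  qed
  then have "dbar P e (0, 0) = D0" by (simp add: dbar_def cInf_atLeast)
  then show ?thesis by (simp add: D0_def K_def s_def ps_def m_def)
qed

definition Astar :: "nk_params \<Rightarrow> real^2^2" where
  "Astar P = vector
     [vector [mxx P, sig P * mxpi P],
      vector [slopeK P * mxx P, beta P * mpipi P + sig P * slopeK P * mxpi P]]"

definition tau :: "nk_params \<Rightarrow> real \<Rightarrow> real" where
  "tau P p = trace (p *\<^sub>R Astar P)"

definition delta :: "nk_params \<Rightarrow> real \<Rightarrow> real" where
  "delta P p = det (p *\<^sub>R Astar P)"

text \<open>The impact multiplier is \<open>m\<close> if, in the equilibrium as a function of \<open>g\<close>, the lower
  bound binds in every low period for \<open>g\<close> near zero, and impact consumption has derivative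
  \<open>m\<close> at each \<open>g\<close> near which the lower bound binds in every low period.\<close>

definition is_elb_multiplier ::
  "nk_params \<Rightarrow> expiry \<Rightarrow> real \<times> real \<Rightarrow> real \<Rightarrow> real \<Rightarrow> nat \<Rightarrow> real \<Rightarrow> bool" where
  "is_elb_multiplier P e ss d p l m \<longleftrightarrow>
     (\<exists>C Pi. (\<forall>g. equilibrium P e ss p (enat l) d g (C g) (Pi g)) \<and>
        (\<forall>\<^sub>F g in nhds 0. elb_binds P e (enat l) (Pi g)) \<and>
        (\<forall>g. (\<forall>\<^sub>F g' in nhds g. elb_binds P e (enat l) (Pi g')) \<longrightarrow>
           ((\<lambda>g'. C g' 0 Low) has_real_derivative m) (at g)))"

definition elb_multiplier ::
  "nk_params \<Rightarrow> expiry \<Rightarrow> real \<times> real \<Rightarrow> real \<Rightarrow> real \<Rightarrow> nat \<Rightarrow> real" where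
  "elb_multiplier P e ss d p l = (THE m. is_elb_multiplier P e ss d p l m)"

text \<open>For the untruncated chain the binding lower bound enters as the equation
  \<open>i = - mu\<close> alone.  The multiplier is then defined whenever the constant allocation is, also
  where this allocation is not the limit of the truncated ones and would violate
  \<open>\<pi> \<le> pibar\<close>.\<close>

definition constant_elb_allocation ::
  "nk_params \<Rightarrow> expiry \<Rightarrow> real \<times> real \<Rightarrow> real \<Rightarrow> real \<Rightarrow> real \<Rightarrow> real \<Rightarrow> real \<Rightarrow> bool" where
  "constant_elb_allocation P e ss d p g cL \<pi>L \<longleftrightarrow>
     (\<forall>n. private_sector P e p \<infinity> d g (- mu P)
        (\<lambda>_ s. case s of Low \<Rightarrow> cL | Absorbing \<Rightarrow> fst ss)
        (\<lambda>_ s. case s of Low \<Rightarrow> \<pi>L | Absorbing \<Rightarrow> snd ss) n Low)"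

definition is_elb_multiplier_inf ::
  "nk_params \<Rightarrow> expiry \<Rightarrow> real \<times> real \<Rightarrow> real \<Rightarrow> real \<Rightarrow> real \<Rightarrow> bool" where
  "is_elb_multiplier_inf P e ss d p m \<longleftrightarrow>
     (\<exists>C Pi. (\<forall>g. constant_elb_allocation P e ss d p g (C g) (Pi g)) \<and>
        (\<forall>g. (C has_real_derivative m) (at g)))"

definition elb_multiplier_inf ::
  "nk_params \<Rightarrow> expiry \<Rightarrow> real \<times> real \<Rightarrow> real \<Rightarrow> real \<Rightarrow> real" where
  "elb_multiplier_inf P e ss d p = (THE m. is_elb_multiplier_inf P e ss d p m)"

end

theory Submission
  imports Defs
begin

text \<open>
  While the lower bound binds, backward induction on the remaining low periods is the affine
  recursion \<open>z \<mapsto> A* (p z + (1 - p) ss) + const\<close> with \<open>A* > 0\<close> entrywise.  Hence a larger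
  demand shock lowers inflation at every low date by at least \<open>K \<sigma>\<close> times its increase, so the
  bound binds strictly for \<open>d > dbar\<close> and stays binding for small \<open>g\<close>.  The derivative in \<open>g\<close>
  is then \<open>w\<^sub>k = (\<Sum>j<k. (p A*)\<^sup>j v)\<close>, whatever the terminal steady state, and Cayley-Hamilton gives
  the AR(2) recursion.  Both eigenvalues of \<open>A*\<close> are real and positive; the threshold is the
  reciprocal of the larger one.  Below it the fixed point of the recursion for \<open>w\<close> is nonnegative
  and bounds the increasing sequence; from it on the increments do not decay.
\<close>

section \<open>One-period map and exit timing\<close>

definition private_response ::
  "nk_params \<Rightarrow> real \<Rightarrow> real \<Rightarrow> real \<Rightarrow> real \<times> real \<Rightarrow> real \<times> real" where
  "private_response P d g i x =
     (let c = mxx P * fst x - sig P * (i - mxpi P * snd x + d)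
      in (c, mpipi P * beta P * snd x + slopeK P * c + kappa P * eta P * (1 - cbar P) * g))"

text \<open>The number of dates at which the chain can be low, with \<open>Exit_After_Expiry\<close>
  allowing one more. Backward induction sees the exit timing only through this number.\<close>

definition low_periods :: "expiry \<Rightarrow> nat \<Rightarrow> nat" where
  "low_periods e l = (case e of Exit_At_Expiry \<Rightarrow> l | Exit_After_Expiry \<Rightarrow> Suc l)"

lemma low_date_iff: "low_date e (enat l) n \<longleftrightarrow> n < low_periods e l"
  by (cases e) (auto simp: low_date_def low_periods_def)

lemma low_date_infinity: "low_date e \<infinity> n"
  by (cases e) (auto simp: low_date_def)

text \<open>Cramer's rule, used for the constant allocation of the untruncated chain and for the
  fixed point of the \<open>response\<close> recursion.\<close>

lemma linear_system_2:
  fixes A B C D r s :: real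
  assumes "A * D - B * C \<noteq> 0"
  shows "A * x - B * y = r \<and> D * y - C * x = s \<longleftrightarrow>
    x = (D * r + B * s) / (A * D - B * C) \<and> y = (C * r + A * s) / (A * D - B * C)"
proof -
  have "x * (A * D - B * C) = D * r + B * s" "y * (A * D - B * C) = C * r + A * s"
    if "r = A * x - B * y" "s = D * y - C * x"
    unfolding that by (simp_all add: algebra_simps)
  moreover have "A * x - B * y = r" "D * y - C * x = s"
    if x: "x * (A * D - B * C) = D * r + B * s" and y: "y * (A * D - B * C) = C * r + A * s"
  proof -
    have "(A * x - B * y) * (A * D - B * C) = A * (D * r + B * s) - B * (C * r + A * s)"
      "(D * y - C * x) * (A * D - B * C) = D * (C * r + A * s) - C * (D * r + B * s)"
      unfolding x[symmetric] y[symmetric] by (simp_all add: algebra_simps)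
    then have "(A * x - B * y) * (A * D - B * C) = r * (A * D - B * C)"
      "(D * y - C * x) * (A * D - B * C) = s * (A * D - B * C)"
      by (simp_all add: algebra_simps)
    then show "A * x - B * y = r" "D * y - C * x = s" using assms by simp_all
  qed
  ultimately show ?thesis unfolding nonzero_eq_divide_eq[OF assms] by metis
qed

text \<open>With \<open>minor_root\<close>, the eigenvalues of \<open>Astar P\<close>; those of its
  multiple by \<open>p\<close> are \<open>p\<close> times as large.\<close>

definition dominant_root :: "nk_params \<Rightarrow> real" where
  "dominant_root P = (tau P 1 + sqrt ((tau P 1)\<^sup>2 - 4 * delta P 1)) / 2"

definition minor_root :: "nk_params \<Rightarrow> real" where
  "minor_root P = (tau P 1 - sqrt ((tau P 1)\<^sup>2 - 4 * delta P 1)) / 2"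

section \<open>Low-state paths and equilibria for a fixed persistence\<close>

locale nk_low_state =
  fixes P :: nk_params and ss :: "real \<times> real" and p :: real
  assumes admissible: "admissible P"
    and steady: "steady_state P ss"
    and p_pos: "0 < p" and p_le_1: "p \<le> 1"
begin

abbreviation a :: real where "a \<equiv> mxx P"
abbreviation b :: real where "b \<equiv> sig P * mxpi P"
abbreviation q :: real where "q \<equiv> mpipi P * beta P"
abbreviation K :: real where "K \<equiv> slopeK P"
abbreviation \<gamma> :: real where "\<gamma> \<equiv> kappa P * eta P * (1 - cbar P)"

lemma pos: "0 < a" "0 < b" "0 < q" "0 < K" "0 < \<gamma>" "0 < sig P" "0 < psi P" "0 < mu P"
  "0 < mxpi P" "0 < mpipi P" "0 < beta P" "0 < kappa P" "0 < eta P" "cbar P < 1"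
  using admissible by (auto simp: admissible_def slopeK_def intro!: mult_pos_pos add_pos_pos)

definition next_mean :: "real \<times> real \<Rightarrow> real \<times> real" where
  "next_mean x = (p * fst x + (1 - p) * fst ss, p * snd x + (1 - p) * snd ss)"

text \<open>Makes the forced exit a case of the random one: with \<open>ss\<close> at index 0 of a
  path, the last low period obeys the same recursion as all others.\<close>

lemma next_mean_ss [simp]: "next_mean ss = ss"
  by (simp add: next_mean_def algebra_simps)

text \<open>Paths are indexed backwards: index \<open>k\<close> is the low-state allocation when at most \<open>k\<close> low
  periods remain, the current one included.\<close>

primrec elb_path :: "real \<Rightarrow> real \<Rightarrow> nat \<Rightarrow> real \<times> real" where
  "elb_path d g 0 = ss"
| "elb_path d g (Suc k) = private_response P d g (- mu P) (next_mean (elb_path d g k))"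

text \<open>The rate solving \<open>i = max {\<psi> \<pi>(i), - \<mu>}\<close>, where \<open>\<pi>(i)\<close> is the inflation that
  the private sector chooses at the rate \<open>i\<close>.\<close>

definition eqm_rate :: "real \<Rightarrow> real \<Rightarrow> real \<times> real \<Rightarrow> real" where
  "eqm_rate d g x =
     max (psi P * snd (private_response P d g 0 x) / (1 + psi P * K * sig P)) (- mu P)"

text \<open>An equilibrium has to be supplied for every \<open>g\<close>, also where the bound is
  slack, so a path is needed that obeys the policy rule everywhere.\<close>

primrec eqm_path :: "real \<Rightarrow> real \<Rightarrow> nat \<Rightarrow> real \<times> real" where
  "eqm_path d g 0 = ss"
| "eqm_path d g (Suc k) =
     private_response P d g (eqm_rate d g (next_mean (eqm_path d g k)))
       (next_mean (eqm_path d g k))"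

lemma snd_private_response:
  "snd (private_response P d g i x) = snd (private_response P d g 0 x) - K * sig P * i"
  by (simp add: private_response_def Let_def algebra_simps)

text \<open>Inflation falls in the rate \<open>i\<close> with slope \<open>K * sig P\<close>, so
  \<psi> \<pi>(i) - i is strictly decreasing. Either its zero lies above the floor and solves the
  rule, or the rule prescribes the floor.\<close>

lemma policy_rate_eqm:
  "policy_rate P (snd (private_response P d g (eqm_rate d g x) x)) = eqm_rate d g x"
proof -
  define y where "y = snd (private_response P d g 0 x)"
  have D: "1 + psi P * K * sig P > 0" using pos by (simp add: add_pos_pos)
  have eq: "psi P * (y - K * sig P * i) - i = psi P * y - (1 + psi P * K * sig P) * i" for i
    by (simp add: algebra_simps)
  show ?thesis
  proof (cases "psi P * y / (1 + psi P * K * sig P) \<le> - mu P")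
    case True
    then have i: "eqm_rate d g x = - mu P" by (simp add: eqm_rate_def y_def)
    have "psi P * y \<le> (1 + psi P * K * sig P) * - mu P"
      using True D by (simp only: pos_divide_le_eq mult.commute)
    then have "psi P * (y - K * sig P * - mu P) \<le> - mu P" using eq[of "- mu P"] by simp
    then show ?thesis
      unfolding i snd_private_response[of _ _ "- mu P"] policy_rate_def y_def by simp
  next
    case False
    then have i: "eqm_rate d g x = psi P * y / (1 + psi P * K * sig P)"
      by (simp add: eqm_rate_def y_def)
    then have "psi P * (y - K * sig P * eqm_rate d g x) = eqm_rate d g x"
      using eq[of "eqm_rate d g x"] D by simp
    then show ?thesis
      using False i unfolding snd_private_response[of _ _ "eqm_rate d g x"] policy_rate_def
      by (simp flip: y_def)
  qed
qed

lemma eqm_rate_elb: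
  assumes "snd (private_response P d g (- mu P) x) \<le> pibar P"
  shows "eqm_rate d g x = - mu P"
proof -
  define y where "y = snd (private_response P d g 0 x)"
  have D: "1 + psi P * K * sig P > 0" using pos by (simp add: add_pos_pos)
  have "y + K * sig P * mu P \<le> - mu P / psi P"
    using assms unfolding snd_private_response[of _ _ "- mu P"] pibar_def y_def by simp
  then have "psi P * y \<le> - mu P * (1 + psi P * K * sig P)"
    using pos by (simp add: field_simps)
  then have "psi P * y / (1 + psi P * K * sig P) \<le> - mu P"
    using D by (simp add: pos_divide_le_eq)
  then show ?thesis by (simp add: eqm_rate_def y_def)
qed

lemma eqm_path_elb:
  assumes "\<And>j. 1 \<le> j \<Longrightarrow> j \<le> k \<Longrightarrow> snd (elb_path d g j) \<le> pibar P"
  shows "eqm_path d g k = elb_path d g k"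
  using assms
proof (induction k)
  case (Suc k)
  have IH: "eqm_path d g k = elb_path d g k" using Suc by simp
  have "eqm_rate d g (next_mean (elb_path d g k)) = - mu P"
    using Suc.prems[of "Suc k"] by (intro eqm_rate_elb) simp
  then show ?case by (simp add: IH)
qed simp

text \<open>At the last low date the continuation is \<open>ss\<close> for sure, which the last
  assumption turns into \<open>next_mean z\<close> with \<open>z = ss\<close>.\<close>

lemma expect_next_path:
  assumes "\<And>n. (x n Absorbing, y n Absorbing) = ss" and "n < low_periods e l"
    and "Suc n < low_periods e l \<Longrightarrow> (x (Suc n) Low, y (Suc n) Low) = z"
    and "Suc n = low_periods e l \<Longrightarrow> z = ss"
  shows "(expect_next e p (enat l) x n Low, expect_next e p (enat l) y n Low) = next_mean z"
proof -
  have "x n Absorbing = fst ss" "y n Absorbing = snd ss" for n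
    using assms(1)[of n] by (auto simp flip: assms(1))
  then show ?thesis
    using assms p_pos p_le_1 next_mean_ss
    by (cases "Suc n < low_periods e l")
       (auto simp: expect_next_low low_date_iff next_mean_def)
qed

lemma private_sector_low:
  "private_sector P e p l d g i c \<pi> n Low \<longleftrightarrow>
   (c n Low, \<pi> n Low) =
     private_response P d g i (expect_next e p l c n Low, expect_next e p l \<pi> n Low)"
  by (auto simp: private_sector_def private_response_def shock_def Let_def)

definition path_c :: "(nat \<Rightarrow> real \<times> real) \<Rightarrow> nat \<Rightarrow> nat \<Rightarrow> state \<Rightarrow> real" where
  "path_c y N n s = (case s of Low \<Rightarrow> fst (y (N - n)) | Absorbing \<Rightarrow> fst ss)"

definition path_\<pi> :: "(nat \<Rightarrow> real \<times> real) \<Rightarrow> nat \<Rightarrow> nat \<Rightarrow> state \<Rightarrow> real" where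
  "path_\<pi> y N n s = (case s of Low \<Rightarrow> snd (y (N - n)) | Absorbing \<Rightarrow> snd ss)"

lemma equilibrium_eqm_path:
  fixes l e
  defines "N \<equiv> low_periods e l"
  shows "equilibrium P e ss p (enat l) d g (path_c (eqm_path d g) N) (path_\<pi> (eqm_path d g) N)"
    (is "equilibrium _ _ _ _ _ _ _ ?c ?\<pi>")
proof -
  have "private_sector P e p (enat l) d g (policy_rate P (?\<pi> n s)) ?c ?\<pi> n s"
    if "s = Low \<longrightarrow> low_date e (enat l) n" for n s
  proof (cases s)
    case Low
    with that have n: "n < N" by (simp add: low_date_iff N_def)
    define k where "k = N - Suc n"
    have k: "N - n = Suc k" using n by (simp add: k_def)
    have E: "(expect_next e p (enat l) ?c n Low, expect_next e p (enat l) ?\<pi> n Low)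
        = next_mean (eqm_path d g k)"
      using n by (intro expect_next_path) (auto simp: path_c_def path_\<pi>_def k_def N_def)
    show ?thesis
      unfolding Low private_sector_low E
      by (simp add: path_c_def path_\<pi>_def k policy_rate_eqm)
  next
    case Absorbing
    then show ?thesis
      using steady by (simp add: private_sector_def expect_next_absorbing shock_def
          path_c_def path_\<pi>_def steady_state_def split_beta algebra_simps)
  qed
  then show ?thesis by (simp add: equilibrium_def path_c_def path_\<pi>_def)
qed

lemma elb_binds_path:
  "elb_binds P e (enat l) (path_\<pi> y (low_periods e l)) \<longleftrightarrow>
   (\<forall>k. 1 \<le> k \<and> k \<le> low_periods e l \<longrightarrow> snd (y k) \<le> pibar P)" (is "?L \<longleftrightarrow> ?R")
proof
  assume L: ?L
  show ?R
  proof (intro allI impI)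
    fix k assume k: "1 \<le> k \<and> k \<le> low_periods e l"
    then have "low_periods e l - k < low_periods e l" "low_periods e l - (low_periods e l - k) = k"
      by auto
    with L show "snd (y k) \<le> pibar P"
      by (fastforce simp: elb_binds_def low_date_iff path_\<pi>_def)
  qed
qed (auto simp: elb_binds_def low_date_iff path_\<pi>_def)

lemma policy_rate_elb: "x \<le> pibar P \<Longrightarrow> policy_rate P x = - mu P"
  using pos by (simp add: pibar_def policy_rate_def field_simps)

lemma elb_step:
  assumes "equilibrium P e ss p (enat l) d g c \<pi>" and "elb_binds P e (enat l) \<pi>"
    and "n < low_periods e l"
  shows "(c n Low, \<pi> n Low) = private_response P d g (- mu P)
    (expect_next e p (enat l) c n Low, expect_next e p (enat l) \<pi> n Low)"
proof -
  have "policy_rate P (\<pi> n Low) = - mu P"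
    using assms by (intro policy_rate_elb) (auto simp: elb_binds_def low_date_iff)
  moreover have "private_sector P e p (enat l) d g (policy_rate P (\<pi> n Low)) c \<pi> n Low"
    using assms by (auto simp: equilibrium_def low_date_iff)
  ultimately show ?thesis by (simp add: private_sector_low)
qed

text \<open>Uniqueness by backward induction from the last low date: once the rate is pinned at the
  floor, expectations determine the current allocation.\<close>

lemma equilibrium_elb_path:
  assumes eq: "equilibrium P e ss p (enat l) d g c \<pi>" and bind: "elb_binds P e (enat l) \<pi>"
    and "k < low_periods e l"
  shows "(c (low_periods e l - Suc k) Low, \<pi> (low_periods e l - Suc k) Low) =
    elb_path d g (Suc k)"
  using assms(3)
proof (induction k)
  case 0
  have E: "(expect_next e p (enat l) c (low_periods e l - 1) Low,
      expect_next e p (enat l) \<pi> (low_periods e l - 1) Low) = next_mean ss"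
    using eq 0 by (intro expect_next_path) (auto simp: equilibrium_def)
  show ?case using elb_step[OF eq bind, of "low_periods e l - 1"] 0 unfolding E by simp
next
  case (Suc k)
  define n where "n = low_periods e l - Suc (Suc k)"
  have n: "n < low_periods e l" "Suc n = low_periods e l - Suc k" "Suc n < low_periods e l"
    using Suc.prems by (auto simp: n_def)
  have E: "(expect_next e p (enat l) c n Low, expect_next e p (enat l) \<pi> n Low)
      = next_mean (elb_path d g (Suc k))"
    using eq n Suc by (intro expect_next_path) (auto simp: equilibrium_def)
  show ?case
    using elb_step[OF eq bind n(1)] unfolding E by (simp add: n_def)
qed

section \<open>Comparative statics in government spending and in the demand shock\<close>

primrec response :: "nat \<Rightarrow> real \<times> real" where
  "response 0 = (0, 0)"
| "response (Suc k) =
     (let c = p * (a * fst (response k) + b * snd (response k))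
      in (c, p * q * snd (response k) + K * c + \<gamma>))"

text \<open>Each step is affine with a linear part free of \<open>d\<close> and \<open>ss\<close>,
  and the terminal value does not move with \<open>g\<close>. So \<open>response\<close> is the
  derivative in \<open>g\<close>, started at zero.\<close>

lemma elb_path_affine:
  "elb_path d g k = (fst (elb_path d 0 k) + g * fst (response k),
    snd (elb_path d 0 k) + g * snd (response k))"
proof (induction k)
  case (Suc k)
  then show ?case
    by (simp only: elb_path.simps response.simps next_mean_def private_response_def Let_def
        fst_conv snd_conv prod.inject) (simp add: algebra_simps)
qed simp

lemma private_response_mono:
  assumes "fst x \<le> fst y" "snd x \<le> snd y" "D \<le> d"
  shows "fst (private_response P d g i x) \<le> fst (private_response P D g i y)"
    and "snd (private_response P d g i x) \<le>
      snd (private_response P D g i y) - K * sig P * (d - D)"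
proof -
  have 1: "a * fst x \<le> a * fst y" "b * snd x \<le> b * snd y" "q * snd x \<le> q * snd y"
    using assms(1,2) pos by (auto intro: mult_left_mono less_imp_le simp del: mult_le_cancel_left_pos)
  then have c: "fst (private_response P d g i x) \<le>
      fst (private_response P D g i y) - sig P * (d - D)"
    by (simp add: private_response_def Let_def algebra_simps)
  moreover have "sig P * (d - D) \<ge> 0" using assms pos by simp
  ultimately show "fst (private_response P d g i x) \<le> fst (private_response P D g i y)"
    by linarith
  have "K * fst (private_response P d g i x) \<le>
      K * (fst (private_response P D g i y) - sig P * (d - D))"
    using c pos by simp
  with 1 show "snd (private_response P d g i x) \<le>
      snd (private_response P D g i y) - K * sig P * (d - D)"
    by (simp add: private_response_def Let_def algebra_simps)
qed

lemma next_mean_mono: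
  "fst x \<le> fst y \<Longrightarrow> fst (next_mean x) \<le> fst (next_mean y)"
  "snd x \<le> snd y \<Longrightarrow> snd (next_mean x) \<le> snd (next_mean y)"
  using p_pos by (auto simp: next_mean_def)

lemma elb_path_antimono:
  assumes "D \<le> d"
  shows "fst (elb_path d g k) \<le> fst (elb_path D g k) \<and>
    snd (elb_path d g k) \<le> snd (elb_path D g k)"
proof (induction k)
  case (Suc k)
  have "K * sig P * (d - D) \<ge> 0" using assms pos by simp
  moreover note private_response_mono[OF next_mean_mono(1) next_mean_mono(2) assms,
      of "elb_path d g k" "elb_path D g k" g "- mu P"]
  ultimately show ?case using Suc by fastforce
qed simp

text \<open>Only the effect of the current shock is counted; lower expectations push inflation the
  same way. The margin is therefore uniform in \<open>k\<close>.\<close>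

lemma elb_path_decrease:
  assumes "D \<le> d"
  shows "snd (elb_path d g (Suc k)) \<le> snd (elb_path D g (Suc k)) - K * sig P * (d - D)"
  using private_response_mono(2)[OF next_mean_mono(1) next_mean_mono(2) assms]
    elb_path_antimono[OF assms] by simp

text \<open>If the first value lies below \<open>ss\<close>, so does every later one by induction,
  and the monotone step then keeps all of them below the first. One condition on \<open>d\<close>
  thus covers all durations.\<close>

lemma elb_path_le_first:
  assumes "fst (elb_path d 0 1) \<le> fst ss" "snd (elb_path d 0 1) \<le> snd ss"
  shows "fst (elb_path d 0 (Suc k)) \<le> fst (elb_path d 0 1) \<and>
    snd (elb_path d 0 (Suc k)) \<le> snd (elb_path d 0 1)"
proof (induction k)
  case (Suc k)
  with assms have "fst (elb_path d 0 (Suc k)) \<le> fst ss" "snd (elb_path d 0 (Suc k)) \<le> snd ss"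
    by linarith+
  then show ?case
    using private_response_mono[OF next_mean_mono(1) next_mean_mono(2) order_refl,
      of "elb_path d 0 (Suc k)" ss d 0 "- mu P"] by simp
qed simp

section \<open>The impact multiplier of the truncated chain\<close>

lemma low_periods_pos: "1 \<le> l \<Longrightarrow> 1 \<le> low_periods e l"
  by (cases e) (auto simp: low_periods_def)

lemma elb_path_binds:
  assumes "equilibrium P e ss p (enat l) d g c \<pi>" "elb_binds P e (enat l) \<pi>"
    and "1 \<le> k" "k \<le> low_periods e l"
  shows "snd (elb_path d g k) \<le> pibar P"
proof -
  obtain j where j: "k = Suc j" using assms(3) by (cases k) auto
  have "(c (low_periods e l - k) Low, \<pi> (low_periods e l - k) Low) = elb_path d g k"
    using equilibrium_elb_path[OF assms(1,2), of j] assms(4) by (simp add: j)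
  then have "snd (elb_path d g k) = \<pi> (low_periods e l - k) Low" by (metis snd_conv)
  then show ?thesis
    using assms by (auto simp: elb_binds_def low_date_iff)
qed

lemma elb_equilibrium_exists:
  assumes "\<And>k. 1 \<le> k \<Longrightarrow> k \<le> low_periods e l \<Longrightarrow> snd (elb_path d g k) \<le> pibar P"
  shows "elb_binds P e (enat l) (path_\<pi> (eqm_path d g) (low_periods e l))"
  unfolding elb_binds_path
proof (intro allI impI)
  fix k assume k: "1 \<le> k \<and> k \<le> low_periods e l"
  then have "eqm_path d g k = elb_path d g k" using assms by (intro eqm_path_elb) auto
  then show "snd (eqm_path d g k) \<le> pibar P" using assms k by simp
qed

text \<open>Any choice of equilibria agrees with the affine \<open>elb_path\<close> near a
  \<open>g\<close> around which the bound binds, so the derivative is forced;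
  \<open>eqm_path\<close> is a choice that exists.\<close>

lemma is_elb_multiplier_iff:
  assumes "1 \<le> l" "D < d"
    and D: "equilibrium P e ss p (enat l) D 0 c \<pi>" "elb_binds P e (enat l) \<pi>"
  shows "is_elb_multiplier P e ss d p l x \<longleftrightarrow> x = fst (response (low_periods e l))"
proof -
  define N where "N = low_periods e l"
  have N: "0 < N" "1 \<le> N" using low_periods_pos[OF assms(1), of e] by (auto simp: N_def)
  have deriv: "((\<lambda>g'. C g' 0 Low) has_real_derivative fst (response N)) (at g)"
    if eq: "\<And>g. equilibrium P e ss p (enat l) d g (C g) (Pi g)"
      and bind: "\<forall>\<^sub>F g' in nhds g. elb_binds P e (enat l) (Pi g')" for C Pi g
  proof -
    have aff: "((\<lambda>g'. fst (elb_path d 0 N) + g' * fst (response N))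
        has_real_derivative fst (response N)) (at g)"
      by (auto intro!: derivative_eq_intros)
    have "\<forall>\<^sub>F g' in nhds g. C g' 0 Low = fst (elb_path d 0 N) + g' * fst (response N)"
      using bind
    proof eventually_elim
      case (elim g')
      have "(C g' 0 Low, Pi g' 0 Low) = elb_path d g' N"
        using equilibrium_elb_path[OF eq elim, of "N - 1"] N by (simp add: N_def)
      then show ?case using elb_path_affine[of d g' N] by simp
    qed
    then show ?thesis using aff by (subst DERIV_cong_ev[OF refl _ refl]) auto
  qed
  \<comment> \<open>At \<open>D\<close> the bound may bind with equality. The gap
    \<open>d - D\<close> makes it strict at each of the finitely many indices, and continuity in
    \<open>g\<close> gives a common neighbourhood of zero.\<close>
  have near0: "\<forall>\<^sub>F g in nhds 0. elb_binds P e (enat l) (path_\<pi> (eqm_path d g) N)"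
  proof -
    have "\<forall>\<^sub>F g in nhds 0. snd (elb_path d g k) < pibar P" if k: "k \<in> {1..N}" for k
    proof -
      obtain j where j: "k = Suc j" using k by (cases k) auto
      have "snd (elb_path d 0 k) \<le> snd (elb_path D 0 k) - K * sig P * (d - D)"
        using elb_path_decrease[of D d 0 j] \<open>D < d\<close> by (simp only: j)
      moreover have "K * sig P * (d - D) > 0" using pos \<open>D < d\<close> by simp
      moreover have "snd (elb_path D 0 k) \<le> pibar P"
        using elb_path_binds[OF D] k by (simp add: N_def)
      ultimately have less: "snd (elb_path d 0 k) + 0 * snd (response k) < pibar P" by simp
      have "((\<lambda>g. snd (elb_path d 0 k) + g * snd (response k)) \<longlongrightarrow>
          snd (elb_path d 0 k) + 0 * snd (response k)) (nhds 0)"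
        by (intro tendsto_intros filterlim_ident)
      from order_tendstoD(2)[OF this less] show ?thesis
        by (rule eventually_mono) (subst elb_path_affine, simp)
    qed
    then have "\<forall>\<^sub>F g in nhds 0. \<forall>k\<in>{1..N}. snd (elb_path d g k) < pibar P"
      by (intro eventually_ball_finite) auto
    then show ?thesis
      by eventually_elim (auto simp: N_def intro!: elb_equilibrium_exists less_imp_le)
  qed
  show ?thesis
  proof
    assume "is_elb_multiplier P e ss d p l x"
    then obtain C Pi where eq: "\<And>g. equilibrium P e ss p (enat l) d g (C g) (Pi g)"
      and bind: "\<forall>\<^sub>F g in nhds 0. elb_binds P e (enat l) (Pi g)"
      and x: "((\<lambda>g'. C g' 0 Low) has_real_derivative x) (at 0)"
      unfolding is_elb_multiplier_def by blast
    from DERIV_unique[OF x deriv[OF eq bind]] show "x = fst (response (low_periods e l))"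
      by (simp add: N_def)
  next
    assume "x = fst (response (low_periods e l))"
    then show "is_elb_multiplier P e ss d p l x"
      unfolding is_elb_multiplier_def
      using equilibrium_eqm_path[of e l d] near0
        deriv[of "\<lambda>g. path_c (eqm_path d g) N" "\<lambda>g. path_\<pi> (eqm_path d g) N"]
      by (intro exI[of _ "\<lambda>g. path_c (eqm_path d g) N"] exI[of _ "\<lambda>g. path_\<pi> (eqm_path d g) N"])
         (simp add: N_def)
  qed
qed

section \<open>Characteristic polynomial, untruncated multiplier and AR(2) recursion\<close>

lemma tau_eq: "tau P p = p * (a + q + K * b)"
  by (simp add: tau_def Astar_def trace_def sum_2 vector_2 algebra_simps)

lemma delta_eq: "delta P p = p\<^sup>2 * (a * q)"
  by (simp add: delta_def Astar_def det_2 vector_2 algebra_simps power2_eq_square)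

text \<open>The determinant of the identity minus \<open>p *\<^sub>R Astar P\<close>, which is also
  that of the linear system for the constant allocation.\<close>

lemma char_eq: "1 - tau P p + delta P p = (1 - p * a) * (1 - p * q) - p * b * K"
  by (simp add: tau_eq delta_eq algebra_simps power2_eq_square)

lemma is_elb_multiplier_inf_iff:
  assumes "1 - tau P p + delta P p \<noteq> 0"
  shows "is_elb_multiplier_inf P e ss d p x \<longleftrightarrow> x = p * b * \<gamma> / (1 - tau P p + delta P p)"
proof -
  define \<Delta> where "\<Delta> = 1 - tau P p + delta P p"
  have \<Delta>: "\<Delta> \<noteq> 0" "\<Delta> = (1 - p * a) * (1 - p * q) - p * b * K"
    using assms char_eq by (auto simp: \<Delta>_def)
  define R1 where "R1 = a * ((1 - p) * fst ss) + b * ((1 - p) * snd ss) + sig P * mu P - sig P * d"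
  define R2 where "R2 = q * ((1 - p) * snd ss)"
  \<comment> \<open>The untruncated chain has the same transition at every date, so the condition
    for all dates collapses to one linear system. Spending enters only its Phillips curve.\<close>
  have alloc: "constant_elb_allocation P e ss d p g c \<pi> \<longleftrightarrow>
      (1 - p * a) * c - p * b * \<pi> = R1 \<and> (1 - p * q) * \<pi> - K * c = R2 + \<gamma> * g" for g c \<pi>
    using p_pos p_le_1
    by (auto simp: constant_elb_allocation_def private_sector_def expect_next_low
        low_date_infinity shock_def R1_def R2_def algebra_simps)
  define C where "C g = ((1 - p * q) * R1 + p * b * (R2 + \<gamma> * g)) / \<Delta>" for g
  define Pi where "Pi g = (K * R1 + (1 - p * a) * (R2 + \<gamma> * g)) / \<Delta>" for g
  have "constant_elb_allocation P e ss d p g c \<pi> \<longleftrightarrow> c = C g \<and> \<pi> = Pi g" for g c \<pi>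
    unfolding alloc C_def Pi_def
    using linear_system_2[of "1 - p * a" "1 - p * q" "p * b" K] \<Delta> by simp
  then have "constant_elb_allocation P e ss d p g (C g) (Pi g)"
    and C: "constant_elb_allocation P e ss d p g c \<pi> \<Longrightarrow> c = C g" for g c \<pi>
    by blast+
  moreover have deriv: "(C has_real_derivative p * b * \<gamma> / \<Delta>) (at g)" for g
    unfolding C_def using \<Delta>(1) by (auto intro!: derivative_eq_intros)
  ultimately show ?thesis
    unfolding is_elb_multiplier_inf_def \<Delta>_def[symmetric]
  proof (intro iffI)
    assume "\<exists>C' Pi'. (\<forall>g. constant_elb_allocation P e ss d p g (C' g) (Pi' g)) \<and>
        (\<forall>g. (C' has_real_derivative x) (at g))"
    then obtain C' Pi' where "\<And>g. constant_elb_allocation P e ss d p g (C' g) (Pi' g)"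
      and C': "(C' has_real_derivative x) (at 0)" by blast
    then have "C' = C" using C by blast
    with C' deriv show "x = p * b * \<gamma> / \<Delta>" using DERIV_unique by blast
  qed blast
qed

text \<open>Cayley-Hamilton for \<open>p *\<^sub>R Astar P\<close>. The impulse \<gamma> hits
  inflation only, so it reaches consumption through the off-diagonal entry
  \<open>p * b\<close>.\<close>

lemma response_AR2:
  "fst (response (k + 2)) =
    tau P p * fst (response (k + 1)) - delta P p * fst (response k) + p * b * \<gamma>"
  by (simp add: Let_def tau_eq delta_eq algebra_simps power2_eq_square)

section \<open>Eigenvalues and growth of the response\<close>

lemma tau_1: "tau P 1 = a + q + K * b" and delta_1: "delta P 1 = a * q"
  by (simp_all add: tau_def delta_def Astar_def trace_def sum_2 det_2 algebra_simps)

text \<open>The discriminant is a square plus four times the positive product of the off-diagonal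
  entries, so the roots are real and distinct; their product \<open>a * q\<close> is positive. The
  bound on \<open>a\<close> serves to sign the fixed point in
  \<open>response_tendsto\<close>.\<close>

lemma roots:
  "tau P p = p * dominant_root P + p * minor_root P"
  "delta P p = p * dominant_root P * (p * minor_root P)"
  "minor_root P < dominant_root P" "0 < minor_root P" "a < dominant_root P"
proof -
  define s where "s = sqrt ((tau P 1)\<^sup>2 - 4 * delta P 1)"
  have disc: "(tau P 1)\<^sup>2 - 4 * delta P 1 = (a - (q + K * b))\<^sup>2 + 4 * (K * a * b)"
    by (simp add: tau_1 delta_1 power2_eq_square algebra_simps)
  have Kab: "0 < K * a * b" "0 < a * q" using pos by simp_all
  have disc_gt: "(a - (q + K * b))\<^sup>2 < (tau P 1)\<^sup>2 - 4 * delta P 1"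
    unfolding disc using Kab by linarith
  then have s2: "s\<^sup>2 = (tau P 1)\<^sup>2 - 4 * delta P 1"
    unfolding s_def by (smt (verit) real_sqrt_pow2 zero_le_power2)
  have s_gt: "\<bar>a - (q + K * b)\<bar> < s"
    unfolding s_def using disc_gt by (intro real_less_rsqrt) simp
  have "s < tau P 1"
    unfolding s_def using Kab pos by (intro real_less_lsqrt) (auto simp: tau_1 delta_1)
  then show "0 < minor_root P" by (simp add: minor_root_def s_def)
  show "minor_root P < dominant_root P" "a < dominant_root P"
    using s_gt unfolding minor_root_def dominant_root_def s_def[symmetric]
    by (auto simp: tau_1)
  show "tau P p = p * dominant_root P + p * minor_root P"
    by (simp add: tau_eq dominant_root_def minor_root_def tau_1 field_simps)
  have "dominant_root P * minor_root P = a * q"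
    unfolding dominant_root_def minor_root_def s_def[symmetric]
    using s2 by (simp add: delta_1 power2_eq_square field_simps)
  then show "delta P p = p * dominant_root P * (p * minor_root P)"
    by (simp add: delta_eq power2_eq_square algebra_simps)
qed

text \<open>With the two roots \<open>x\<^sub>1 > x\<^sub>2\<close> of the recursion, its increments \<open>\<Delta>\<^sub>k\<close> satisfy
  \<open>\<Delta>\<^sub>k\<^sub>+\<^sub>1 - x\<^sub>2 \<Delta>\<^sub>k = x\<^sub>1\<^sup>k \<Delta>\<^sub>1\<close>, since \<open>\<Delta>\<^sub>0 = 0\<close>.\<close>

lemma response_increment:
  "fst (response (k + 1)) - fst (response k) \<ge> 0"
  "fst (response (k + 2)) - fst (response (k + 1)) \<ge> (p * dominant_root P) ^ k * (p * b * \<gamma>)"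
proof -
  define x1 x2 \<Delta> where "x1 = p * dominant_root P" and "x2 = p * minor_root P"
    and "\<Delta> k = fst (response (k + 1)) - fst (response k)" for k
  have x: "0 < x1" "0 < x2" using roots p_pos by (simp_all add: x1_def x2_def)
  have rec: "\<Delta> (k + 2) = (x1 + x2) * \<Delta> (k + 1) - x1 * x2 * \<Delta> k" for k
    using response_AR2[of k] response_AR2[of "k + 1"]
    by (simp add: \<Delta>_def roots(1,2) algebra_simps flip: x1_def x2_def)
  have eq: "\<Delta> (k + 1) = x2 * \<Delta> k + x1 ^ k * (p * b * \<gamma>)" for k
  proof (induction k)
    case 0
    then show ?case by (simp add: \<Delta>_def Let_def)
  next
    case (Suc k)
    have "\<Delta> (Suc k + 1) - x2 * \<Delta> (Suc k) = x1 * (\<Delta> (k + 1) - x2 * \<Delta> k)"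
      using rec[of k] by (simp add: algebra_simps)
    also have "\<Delta> (k + 1) - x2 * \<Delta> k = x1 ^ k * (p * b * \<gamma>)" using Suc by linarith
    finally show ?case by (simp only: power_Suc mult.assoc)
  qed
  have c: "0 < p * b * \<gamma>" using pos p_pos by simp
  have nonneg: "0 \<le> \<Delta> k" for k
  proof (induction k)
    case 0
    then show ?case by (simp add: \<Delta>_def)
  next
    case (Suc k)
    then show ?case using eq[of k] x c by (simp add: add_nonneg_nonneg)
  qed
  then show "fst (response (k + 1)) - fst (response k) \<ge> 0" by (simp add: \<Delta>_def)
  have "x1 ^ k * (p * b * \<gamma>) \<le> \<Delta> (k + 1)"
    using eq[of k] nonneg[of k] x by simp
  then show "fst (response (k + 2)) - fst (response (k + 1)) \<ge>
      (p * dominant_root P) ^ k * (p * b * \<gamma>)" by (simp add: \<Delta>_def x1_def)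
qed

text \<open>The shift by \<open>Suc\<close> matters: consumption responds by zero at index 0 and at
  index 1.\<close>

lemma response_strict_mono: "strict_mono (\<lambda>k. fst (response (Suc k)))"
proof (rule strict_monoI_Suc)
  fix k
  have "0 < (p * dominant_root P) ^ k * (p * b * \<gamma>)"
    using pos p_pos roots by (intro mult_pos_pos zero_less_power) auto
  then show "fst (response (Suc k)) < fst (response (Suc (Suc k)))"
    using response_increment(2)[of k] by simp
qed

text \<open>In the last low period the rate is fixed and expectations are those of
  \<open>ss\<close>, so spending moves inflation but not consumption.\<close>

lemma response_1: "fst (response 1) = 0"
  by (simp add: Let_def)

text \<open>From the threshold on, the geometric factor in the increments is at least 1, so growth
  is at least linear, also at the threshold itself.\<close>

lemma response_at_top:
  assumes "1 / dominant_root P \<le> p"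
  shows "filterlim (\<lambda>k. fst (response k)) at_top sequentially"
proof -
  have "1 \<le> p * dominant_root P" using assms roots by (simp add: field_simps)
  then have one: "1 \<le> (p * dominant_root P) ^ k" for k by (rule one_le_power)
  have c: "0 < p * b * \<gamma>" using pos p_pos by simp
  have bound: "real k * (p * b * \<gamma>) \<le> fst (response (k + 1))" for k
  proof (induction k)
    case (Suc k)
    have "1 * (p * b * \<gamma>) \<le> (p * dominant_root P) ^ k * (p * b * \<gamma>)"
      using one c by (intro mult_right_mono) auto
    with Suc response_increment(2)[of k] show ?case
      by (simp del: response.simps add: algebra_simps)
  qed (simp add: Let_def)
  have "filterlim (\<lambda>k. p * b * \<gamma> * real k) at_top sequentially"
    by (rule filterlim_tendsto_pos_mult_at_top[OF tendsto_const c filterlim_real_sequentially])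
  then have "filterlim (\<lambda>k. fst (response (k + 1))) at_top sequentially"
    by (rule filterlim_at_top_mono) (use bound in \<open>auto simp: mult.commute simp del: response.simps\<close>)
  then show ?thesis
    using filterlim_sequentially_Suc[of "\<lambda>k. fst (response k)"] by simp
qed

lemma char_pos:
  assumes "p < 1 / dominant_root P"
  shows "0 < 1 - tau P p + delta P p"
proof -
  have "p * dominant_root P < 1" using assms roots by (simp add: field_simps)
  moreover have "p * minor_root P < p * dominant_root P" using roots p_pos by simp
  ultimately have "0 < (1 - p * dominant_root P) * (1 - p * minor_root P)" by simp
  then show ?thesis by (simp add: roots algebra_simps)
qed

lemma response_tendsto:
  assumes p: "p < 1 / dominant_root P"
  shows "(\<lambda>k. fst (response k)) \<longlonglongrightarrow> p * b * \<gamma> / (1 - tau P p + delta P p)"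
proof -
  define \<Delta> where "\<Delta> = 1 - tau P p + delta P p"
  have \<Delta>: "0 < \<Delta>" "\<Delta> = (1 - p * a) * (1 - p * q) - p * b * K"
    using char_pos[OF p] char_eq by (auto simp: \<Delta>_def)
  \<comment> \<open>The fixed point of the \<open>response\<close> recursion by Cramer's rule. It is
    nonnegative because \<Delta> is positive and \<open>p * a < p * dominant_root P < 1\<close>; the
    recursion is monotone and starts below it.\<close>
  define u v where "u = p * b * \<gamma> / \<Delta>" and "v = (1 - p * a) * \<gamma> / \<Delta>"
  have "p * dominant_root P < 1" using p roots by (simp add: field_simps)
  moreover have "p * a < p * dominant_root P" using roots p_pos by simp
  ultimately have "p * a < 1" by linarith
  then have uv: "0 \<le> u" "0 \<le> v" using \<Delta>(1) pos p_pos by (simp_all add: u_def v_def)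
  have "(1 - p * a) * u - p * b * v = 0 \<and> (1 - p * q) * v - K * u = \<gamma>"
    using linear_system_2[of "1 - p * a" "1 - p * q" "p * b" K u v 0 \<gamma>] \<Delta>
    by (simp add: u_def v_def)
  then have u: "p * (a * u + b * v) = u" and v: "p * q * v + K * u + \<gamma> = v"
    by (simp_all add: algebra_simps)
  have le: "fst (response k) \<le> u \<and> snd (response k) \<le> v" for k
  proof (induction k)
    case (Suc k)
    have "a * fst (response k) + b * snd (response k) \<le> a * u + b * v"
      using Suc pos by (intro add_mono mult_left_mono) auto
    then have "p * (a * fst (response k) + b * snd (response k)) \<le> p * (a * u + b * v)"
      using p_pos by (intro mult_left_mono) auto
    then have 1: "p * (a * fst (response k) + b * snd (response k)) \<le> u"
      by (simp only: u)
    have "p * q * snd (response k) \<le> p * q * v"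
      using Suc pos p_pos by (intro mult_left_mono) auto
    moreover have "K * (p * (a * fst (response k) + b * snd (response k))) \<le> K * u"
      using 1 pos by (intro mult_left_mono) auto
    ultimately show ?case using 1 v by (simp add: Let_def)
  qed (simp add: uv)
  have "incseq (\<lambda>k. fst (response k))"
    using response_increment(1) by (intro incseq_SucI) (simp del: response.simps)
  then obtain L where L: "(\<lambda>k. fst (response k)) \<longlonglongrightarrow> L"
    using incseq_convergent[of "\<lambda>k. fst (response k)" u] le by blast
  \<comment> \<open>Passing to the limit in the scalar recursion identifies \<open>L\<close> from
    the consumption component alone.\<close>
  have "(\<lambda>k. tau P p * fst (response (k + 1)) - delta P p * fst (response k) + p * b * \<gamma>)
      \<longlonglongrightarrow> tau P p * L - delta P p * L + p * b * \<gamma>"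
    using L LIMSEQ_ignore_initial_segment[OF L, of 1] by (intro tendsto_intros)
  then have "(\<lambda>k. fst (response (k + 2))) \<longlonglongrightarrow> tau P p * L - delta P p * L + p * b * \<gamma>"
    by (simp only: response_AR2)
  from LIMSEQ_unique[OF this LIMSEQ_ignore_initial_segment[OF L, of 2]]
  have "L * \<Delta> = p * b * \<gamma>" by (simp add: \<Delta>_def algebra_simps)
  then have "L = p * b * \<gamma> / \<Delta>" using \<Delta>(1) by (simp add: field_simps)
  with L show ?thesis by (simp add: \<Delta>_def)
qed

end

lemma dbar_less_obtains:
  assumes P: "admissible P" and ss: "steady_state P ss" and d: "dbar P e ss < d"
  obtains D where "D < d"
    and "\<And>p l. p \<in> {0<..1} \<Longrightarrow> 1 \<le> l \<Longrightarrow>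
      \<exists>c \<pi>. equilibrium P e ss p (enat l) D 0 c \<pi> \<and> elb_binds P e (enat l) \<pi>"
proof -
  \<comment> \<open>\<open>cInf_lessD\<close> yields an element below \<open>d\<close> only for a
    nonempty set, so a shock that makes the bound bind for all \<open>p\<close> and \<open>l\<close>
    has to be exhibited.\<close>
  define S where "S = {D. \<forall>d\<ge>D. \<forall>p\<in>{0<..1}. \<forall>l\<ge>1.
     \<exists>c \<pi>. equilibrium P e ss p (enat l) d 0 c \<pi> \<and> elb_binds P e (enat l) \<pi>}"
  interpret one: nk_low_state P ss 1 using P ss by unfold_locales auto
  define y where "y = private_response P 0 0 (- mu P) ss"
  have y1: "private_response P D 0 (- mu P) ss =
      (fst y - sig P * D, snd y - slopeK P * sig P * D)" for D
    by (simp add: y_def private_response_def Let_def algebra_simps)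
  have Ks: "0 < slopeK P * sig P" "0 < sig P" using one.pos by auto
  \<comment> \<open>Large enough to put the first low value below \<open>ss\<close> in both
    components and its inflation below \<open>pibar P\<close>.\<close>
  define D1 where "D1 = Max {0, (fst y - fst ss) / sig P, (snd y - snd ss) / (slopeK P * sig P),
    (snd y - pibar P) / (slopeK P * sig P)}"
  have D1: "fst y - sig P * D \<le> fst ss" "snd y - slopeK P * sig P * D \<le> snd ss"
    "snd y - slopeK P * sig P * D \<le> pibar P" if "D1 \<le> D" for D
  proof -
    have "(fst y - fst ss) / sig P \<le> D" "(snd y - snd ss) / (slopeK P * sig P) \<le> D"
      "(snd y - pibar P) / (slopeK P * sig P) \<le> D"
      using that by (auto simp: D1_def)
    then show "fst y - sig P * D \<le> fst ss" "snd y - slopeK P * sig P * D \<le> snd ss"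
      "snd y - slopeK P * sig P * D \<le> pibar P"
      using Ks by (simp_all add: pos_divide_le_eq algebra_simps)
  qed
  have "D1 \<in> S"
    unfolding S_def
  proof (intro CollectI allI ballI impI)
    fix D p :: real and l :: nat
    assume D: "D1 \<le> D" and p: "p \<in> {0<..1}" and "1 \<le> l"
    interpret nk_low_state P ss p using P ss p by unfold_locales auto
    have "snd (elb_path D 0 k) \<le> pibar P" if "1 \<le> k" for k
    proof -
      obtain j where j: "k = Suc j" using \<open>1 \<le> k\<close> by (cases k) auto
      \<comment> \<open>Since \<open>next_mean ss = ss\<close>, this value is free of
        \<open>p\<close>, so \<open>D1\<close> works for every \<open>p\<close> and
        \<open>l\<close>.\<close>
      have "elb_path D 0 1 = private_response P D 0 (- mu P) ss" by simp
      then show ?thesis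
        using elb_path_le_first[of D j] D1[OF D] unfolding j y1 by simp
    qed
    then have "elb_binds P e (enat l) (path_\<pi> (eqm_path D 0) (low_periods e l))"
      by (intro elb_equilibrium_exists)
    with equilibrium_eqm_path show "\<exists>c \<pi>. equilibrium P e ss p (enat l) D 0 c \<pi> \<and>
      elb_binds P e (enat l) \<pi>" by blast
  qed
  then have "S \<noteq> {}" by blast
  moreover have "Inf S < d" using d by (simp add: dbar_def S_def)
  ultimately obtain D where "D \<in> S" "D < d" using cInf_lessD by blast
  then show thesis by (intro that[of D]) (auto simp: S_def)
qed

theorem proposition8:
  fixes P :: nk_params and e :: expiry and ss :: "real \<times> real" and d :: real
  assumes "admissible P"
    and "intended ss \<or> unintended P ss"
    and "psi P > mxpi P + (1 - mxx P) * (beta P * mpipi P - 1)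
                          / (kappa P * (1 + eta P * cbar P) * sig P)"
    and "d > dbar P e ss"
  defines "m \<equiv> elb_multiplier P e ss d"
    and "m_inf \<equiv> elb_multiplier_inf P e ss d"
  shows "(\<forall>p\<in>{0<..1}.
            (\<forall>l\<ge>1. \<exists>!x. is_elb_multiplier P e ss d p l x) \<and>
            (\<forall>l\<ge>1. if e = Exit_At_Expiry \<and> l = 1 then m p l = 0 else m p l > 0) \<and>
            strict_mono_on {1..} (m p) \<and>
            (\<exists>c_m. (1 - tau P p + delta P p \<noteq> 0 \<longrightarrow>
                      (\<exists>!x. is_elb_multiplier_inf P e ss d p x) \<and>
                      c_m = (1 - tau P p + delta P p) * m_inf p) \<and>
                   (\<forall>l\<ge>1. m p (l + 2) = tau P p * m p (l + 1) - delta P p * m p l + c_m))) \<and>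
         (\<exists>pbar. \<forall>p\<in>{0<..1}.
            (p < pbar \<longrightarrow> (\<exists>!x. is_elb_multiplier_inf P e ss d p x) \<and>
                         m_inf p > 0 \<and> (m p \<longlonglongrightarrow> m_inf p)) \<and>
            (p \<ge> pbar \<longrightarrow> filterlim (m p) at_top sequentially))"
proof -
  have ss: "steady_state P ss"
    using assms(1,2) by (auto simp: intended_def unintended_def steady_state_def policy_rate_def
        admissible_def)
  obtain D where D: "D < d" "\<And>p l. p \<in> {0<..1} \<Longrightarrow> 1 \<le> l \<Longrightarrow>
      \<exists>c \<pi>. equilibrium P e ss p (enat l) D 0 c \<pi> \<and> elb_binds P e (enat l) \<pi>"
    using dbar_less_obtains[OF assms(1) ss assms(4)] by blast
  \<comment> \<open>The offset \<open>j\<close> is 0 or 1 according to the exit timing; the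
    multiplier at \<open>l\<close> is the response at index \<open>l + j\<close>.\<close>
  have shift: "\<exists>j. \<forall>l. low_periods e l = l + j \<and> (j = 0 \<longleftrightarrow> e = Exit_At_Expiry)"
    by (cases e) (auto simp: low_periods_def)
  then obtain j where j: "\<And>l. low_periods e l = l + j" "j = 0 \<longleftrightarrow> e = Exit_At_Expiry"
    by blast
  have low_state: "nk_low_state P ss p" if "p \<in> {0<..1}" for p
    using assms(1) ss that by unfold_locales auto
  have iff: "is_elb_multiplier P e ss d p l x \<longleftrightarrow> x = fst (nk_low_state.response P p (l + j))"
    if pl: "p \<in> {0<..1}" "1 \<le> l" for p l x
  proof -
    obtain c \<pi> where "equilibrium P e ss p (enat l) D 0 c \<pi>" "elb_binds P e (enat l) \<pi>"
      using D(2)[OF pl] by blast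
    from nk_low_state.is_elb_multiplier_iff[OF low_state[OF pl(1)] pl(2) D(1) this]
    show ?thesis by (simp only: j(1))
  qed
  have m: "m p l = fst (nk_low_state.response P p (l + j))" if "p \<in> {0<..1}" "1 \<le> l" for p l
    unfolding m_def elb_multiplier_def iff[OF that] by simp
  have seq: "(\<forall>l\<ge>1. if e = Exit_At_Expiry \<and> l = 1 then m p l = 0 else m p l > 0) \<and>
      strict_mono_on {1..} (m p) \<and>
      (\<forall>l\<ge>1. m p (l + 2) = tau P p * m p (l + 1) - delta P p * m p l
        + p * (sig P * mxpi P) * (kappa P * eta P * (1 - cbar P)))"
    if p: "p \<in> {0<..1}" for p
  proof -
    interpret nk_low_state P ss p by (rule low_state[OF p])
    have mono: "fst (response k) < fst (response n)" if "1 \<le> k" "k < n" for k n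
      using strict_monoD[OF response_strict_mono, of "k - 1" "n - 1"] that
      by (simp del: response.simps)
    \<comment> \<open>The index \<open>l + j\<close> equals 1 exactly in the exceptional case, where
      \<open>response_1\<close> gives zero; otherwise it exceeds 1.\<close>
    have "if e = Exit_At_Expiry \<and> l = 1 then m p l = 0 else m p l > 0" if "1 \<le> l" for l
      using mono[of 1 "l + j"] response_1 j(2) m[OF p that] that
      by (auto simp del: response.simps)
    moreover have "strict_mono_on {1..} (m p)"
      using mono by (intro strict_mono_onI) (simp add: m[OF p])
    moreover have "m p (l + 2) = tau P p * m p (l + 1) - delta P p * m p l
        + p * (sig P * mxpi P) * (kappa P * eta P * (1 - cbar P))" if "1 \<le> l" for l
      using response_AR2[of "l + j"] that m[OF p]
      by (simp del: response.simps add: ac_simps)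
    ultimately show ?thesis by blast
  qed
  have inf: "(\<exists>!x. is_elb_multiplier_inf P e ss d p x) \<and>
      m_inf p = p * (sig P * mxpi P) * (kappa P * eta P * (1 - cbar P)) / (1 - tau P p + delta P p)"
    if p: "p \<in> {0<..1}" and "1 - tau P p + delta P p \<noteq> 0" for p
    using nk_low_state.is_elb_multiplier_inf_iff[OF low_state[OF p] that(2)]
    by (simp add: m_inf_def elb_multiplier_inf_def)
  \<comment> \<open>The multiplier is identified only for \<open>l\<close> at least 1 and at a
    shifted index; neither affects limits.\<close>
  have limit: "filterlim (m p) F sequentially"
    if p: "p \<in> {0<..1}" and "filterlim (\<lambda>k. fst (nk_low_state.response P p k)) F sequentially"
    for p F
  proof -
    have "filterlim (\<lambda>l. fst (nk_low_state.response P p (l + j))) F sequentially"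
      using that(2) by (rule filterlim_compose) (rule filterlim_add_const_nat_at_top)
    moreover have "\<forall>\<^sub>F l in sequentially. m p l = fst (nk_low_state.response P p (l + j))"
      using eventually_ge_at_top[of 1] by eventually_elim (rule m[OF p])
    ultimately show ?thesis by (simp add: filterlim_cong)
  qed
  \<comment> \<open>Depends on \<open>P\<close> alone, so it is one threshold for all
    \<open>p\<close>. It may exceed 1, and then the divergent case is empty.\<close>
  define pbar where "pbar = 1 / dominant_root P"
  have low: "(\<exists>!x. is_elb_multiplier_inf P e ss d p x) \<and> m_inf p > 0 \<and> (m p \<longlonglongrightarrow> m_inf p)"
    if p: "p \<in> {0<..1}" "p < pbar" for p
  proof -
    interpret nk_low_state P ss p by (rule low_state[OF p(1)])
    have c: "0 < 1 - tau P p + delta P p" using p(2) by (intro char_pos) (simp add: pbar_def)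
    have "m p \<longlonglongrightarrow> m_inf p"
      using limit[OF p(1) response_tendsto] p(2) inf[OF p(1)] c by (simp add: pbar_def)
    then show ?thesis using inf[OF p(1)] c pos p_pos by simp
  qed
  have high: "filterlim (m p) at_top sequentially" if p: "p \<in> {0<..1}" "pbar \<le> p" for p
    using limit[OF p(1) nk_low_state.response_at_top[OF low_state[OF p(1)]]] p(2)
    by (simp add: pbar_def)
  show ?thesis
  proof (intro conjI ballI)
    fix p :: real
    assume p: "p \<in> {0<..1}"
    show "\<forall>l\<ge>1. \<exists>!x. is_elb_multiplier P e ss d p l x" using iff[OF p] by simp
    show "\<forall>l\<ge>1. if e = Exit_At_Expiry \<and> l = 1 then m p l = 0 else m p l > 0"
      "strict_mono_on {1..} (m p)"
      using seq[OF p] by blast+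
    \<comment> \<open>The witness is the constant of \<open>response_AR2\<close>. It stays
      meaningful where the characteristic polynomial vanishes and equals the stated product
      elsewhere.\<close>
    show "\<exists>c_m. (1 - tau P p + delta P p \<noteq> 0 \<longrightarrow>
                  (\<exists>!x. is_elb_multiplier_inf P e ss d p x) \<and>
                  c_m = (1 - tau P p + delta P p) * m_inf p) \<and>
               (\<forall>l\<ge>1. m p (l + 2) = tau P p * m p (l + 1) - delta P p * m p l + c_m)"
      using seq[OF p] inf[OF p]
      by (intro exI[of _ "p * (sig P * mxpi P) * (kappa P * eta P * (1 - cbar P))"]) simp
  next
    show "\<exists>pbar. \<forall>p\<in>{0<..1}.
            (p < pbar \<longrightarrow> (\<exists>!x. is_elb_multiplier_inf P e ss d p x) \<and>
                         m_inf p > 0 \<and> (m p \<longlonglongrightarrow> m_inf p)) \<and>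
            (p \<ge> pbar \<longrightarrow> filterlim (m p) at_top sequentially)"
      using low high by blast
  qed
qed

end
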